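(* For all $\beta_1,\beta_2>1$ with $\beta_1\neq\beta_2$, the set $U_{\beta_1,\beta_2}$ has positive topological entropy.
   Context: Write $p=+1$, $m=-1$. For $\beta_1,\beta_2>1$ define $\pi:\{p,m\}^{\mathbb N}\to\mathbb R^2$ by $\pi(w)=\left(\sum_{i\ge1}w_i\beta_1^{-i},\sum_{i\ge1}w_i\beta_2^{-i}\right)$. Let $U_{\beta_1,\beta_2}$ be the set of unique addresses, i.e. of $w\in\{p,m\}^{\mathbb N}$ such that $\pi(w')\ne\pi(w)$ for every $w'\in\{p,m\}^{\mathbb N}$ with $w'\neq w$. For $\mathcal L\subset\{p,m\}^{\mathbb N}$ let $E_n(\mathcal L)$ be the number of words $a_1\dots a_n\in\{p,m\}^n$ that are prefixes of some infinite word in $\mathcal L$. The set $\mathcal L$ has positive topological entropy if $\liminf_{n\to\infty}\frac{\log E_n(\mathcal L)}{n}>0$. *)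

theory Defs
  imports "HOL-Analysis.Analysis"
begin

datatype letter = LetterP | LetterM

fun letter_val :: "letter \<Rightarrow> real" where
  "letter_val LetterP = 1"
| "letter_val LetterM = -1"

(* Infinite words w_1 w_2 w_3 ... are functions on nat, where "w i" is the letter w_{i+1};
   hence the exponent "Suc i" below. *)
type_synonym word = "nat \<Rightarrow> letter"

(* For b1, b2 > 1 both series converge absolutely. *)
definition proj :: "real \<Rightarrow> real \<Rightarrow> word \<Rightarrow> real \<times> real" where
  "proj b1 b2 w =
     ((\<Sum>i. letter_val (w i) / b1 ^ Suc i), (\<Sum>i. letter_val (w i) / b2 ^ Suc i))"

definition unique_addresses :: "real \<Rightarrow> real \<Rightarrow> word set" where
  "unique_addresses b1 b2 = {w. \<forall>w'. w' \<noteq> w \<longrightarrow> proj b1 b2 w' \<noteq> proj b1 b2 w}"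

definition prefixes_of :: "nat \<Rightarrow> word set \<Rightarrow> letter list set" where
  "prefixes_of n L = {a. \<exists>w\<in>L. a = map w [0..<n]}"

definition num_prefixes :: "nat \<Rightarrow> word set \<Rightarrow> nat" where
  "num_prefixes n L = card (prefixes_of n L)"

(* The liminf is taken in the extended reals. If L is empty, then "ln 0 = 0" makes the
   liminf 0 rather than -\<infinity>; it fails to be positive in either case. *)
definition positive_topological_entropy :: "word set \<Rightarrow> bool" where
  "positive_topological_entropy L \<longleftrightarrow>
     liminf (\<lambda>n. ereal (ln (real (num_prefixes n L)) / real n)) > 0"

end

theory Submission
  imports Defs
begin

text \<open>
  A word \<open>w\<close> fails to be a unique address iff there is a nonzero sequence \<open>d\<close> with
  \<open>d i \<in> {0, w i}\<close> that is orthogonal to both geometric sequences \<open>x ^ i\<close> and \<open>y ^ i\<close>,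
  where \<open>x\<close> and \<open>y\<close> are the reciprocals of the two bases, and hence orthogonal to every
  combination \<open>f i = c * y ^ i - x ^ i\<close>. Let \<open>y < x\<close>. Such an \<open>f\<close> changes sign exactly once,
  from positive to negative, and the place of the change can be prescribed by \<open>c\<close>. Put it at
  the end of the run of \<open>w\<close> that contains the first nonzero entry of \<open>d\<close>. Up to a global sign,
  \<open>d\<close> and \<open>f\<close> then agree in sign on the remainder of that run and on the whole of the next run.
  Only the indices after the second run can contribute with the wrong sign, and if the second run
  is long, their total is smaller than the contribution of the first nonzero entry. The required
  length depends on \<open>x\<close> and \<open>y\<close> only, so there is an \<open>L\<close> such that every word whose runs all have
  length at least \<open>L\<close> is a unique address (\<open>long_runs_unique_address\<close>). For instance one can
  repeat each letter of an arbitrary word \<open>L\<close> times. These words have at least \<open>2 ^ (n div L)\<close>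
  prefixes of length \<open>n\<close>, and so the entropy is positive.
\<close>

section \<open>Words with long runs are unique addresses\<close>

text \<open>
  The condition is imposed where the letter changes, so that the first run may be short and
  the property passes to tails of a word, where the first run is cut off.
\<close>

definition long_runs :: "nat \<Rightarrow> (nat \<Rightarrow> 'a) \<Rightarrow> bool" where
  "long_runs L w \<longleftrightarrow> (\<forall>k j. w (Suc k) \<noteq> w k \<longrightarrow> j < L \<longrightarrow> w (Suc k + j) = w (Suc k))"

lemma letter_val_mult:
  "letter_val a * letter_val b = (if a = b then 1 else -1)"
  by (cases a; cases b) auto

text \<open>
  The ratio \<open>x / y\<close> is written as \<open>r\<^sup>2\<close> so that the sign change of \<open>c * y ^ i - x ^ i\<close> can be put
  half-way between two consecutive indices: on either side of it, the ratio of the two terms is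
  then at least \<open>r\<close>, which bounds the combination away from zero. Relative to \<open>x ^ n\<close>, where \<open>n\<close>
  is the first index with \<open>d n \<noteq> 0\<close>, this index contributes at least \<open>r - 1\<close> to the sum, and
  the indices after the second run take away at most \<open>x ^ L / (1 - x)\<close>.
\<close>

lemma long_runs_orthogonal_imp_zero:
  fixes x y r :: real and d :: "nat \<Rightarrow> real"
  assumes x: "0 < x" "x < 1" and r: "1 < r" and y: "y = x / r\<^sup>2"
    and L: "x ^ L / (1 - x) < r - 1"
    and runs: "long_runs L w"
    and d: "\<And>i. d i = 0 \<or> d i = letter_val (w i)"
    and sx: "(\<lambda>i. d i * x ^ i) sums 0" and sy: "(\<lambda>i. d i * y ^ i) sums 0"
  shows "d i = 0"
proof (rule ccontr)
  assume "d i \<noteq> 0"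
  define n where "n = (LEAST n. d n \<noteq> 0)"
  have dn: "d n \<noteq> 0" unfolding n_def by (rule LeastI) fact
  have before: "d i = 0" if "i < n" for i
    using that not_less_Least unfolding n_def by blast
  define s where "s = letter_val (w n)"
  have sd_same: "s * d i \<in> {0, 1}" if "w i = w n" for i
    using d[of i] that by (auto simp: s_def letter_val_mult)
  have sd_diff: "s * d i \<in> {0, -1}" if "w i \<noteq> w n" for i
    using d[of i] that by (auto simp: s_def letter_val_mult)
  have sdn: "s * d n = 1"
    using d[of n] dn by (auto simp: s_def letter_val_mult)
  show False
  proof (cases "\<exists>k>n. w k \<noteq> w n")
    case False
    \<comment> \<open>The run is infinite, and the sequence \<open>x ^ i\<close> alone gives the contradiction.\<close>
    have "(\<lambda>i. s * (d i * x ^ i)) sums (s * 0)" by (intro sums_mult sx)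
    moreover have "(\<lambda>i. if i = n then x ^ n else 0) sums x ^ n"
      using sums_single[of n "\<lambda>_. x ^ n"] by simp
    moreover have "(if i = n then x ^ n else 0) \<le> s * (d i * x ^ i)" for i
    proof (cases "i < n")
      case True
      then show ?thesis using before by simp
    next
      case F: False
      then have "w i = w n" using False by (metis nat_neq_iff)
      then have "s * d i \<in> {0, 1}" by (rule sd_same)
      then show ?thesis
        using x sdn by (auto simp: mult.assoc[symmetric])
    qed
    ultimately have "x ^ n \<le> s * 0" by (meson sums_le)
    then show False using zero_less_power[OF x(1), of n] by simp
  next
    case True
    define k where "k = (LEAST k. k > n \<and> w k \<noteq> w n)"
    have k: "k > n" "w k \<noteq> w n"
      using LeastI_ex[of "\<lambda>k. k > n \<and> w k \<noteq> w n"] True unfolding k_def by auto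
    have same: "w i = w n" if "n \<le> i" "i < k" for i
      using not_less_Least[of i "\<lambda>k. k > n \<and> w k \<noteq> w n"] that unfolding k_def
      by (cases "i = n") auto
    obtain k' where k': "k = Suc k'" using k by (cases k) auto
    have next_run: "w i = w k" if "k \<le> i" "i < k + L" for i
    proof -
      have "w (Suc k') \<noteq> w k'" using k k' same[of k'] by auto
      moreover have "i - k < L" using that by linarith
      ultimately have "w (Suc k' + (i - k)) = w (Suc k')"
        using runs unfolding long_runs_def by blast
      then show ?thesis using k' that by simp
    qed
    \<comment> \<open>With this constant, the ratio of \<open>c * y ^ i\<close> to \<open>x ^ i\<close> is \<open>r\<close> raised to the integer
        \<open>2 * (k - i) - 1\<close>, which is positive for \<open>i < k\<close> and negative for \<open>i \<ge> k\<close>.\<close>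
    define c where "c = r ^ (2 * k) / r"
    define f where "f i = c * y ^ i - x ^ i" for i
    have rpos: "0 < r" using r by simp
    have cpos: "0 \<le> c" using rpos by (simp add: c_def)
    have ypos: "0 < y" using x rpos y by simp
    have cy: "c * y ^ i = x ^ i * (r ^ (2 * k) / (r * r ^ (2 * i)))" for i
      by (simp add: c_def y power_divide power_mult)
    have f_ge: "x ^ i * (r - 1) \<le> f i" if "i < k" for i
    proof -
      have "r * (r * r ^ (2 * i)) = r ^ (2 * i + 2)" by (simp add: power_add power2_eq_square)
      also have "\<dots> \<le> r ^ (2 * k)" using r that by (intro power_increasing) auto
      finally have "r \<le> r ^ (2 * k) / (r * r ^ (2 * i))"
        using rpos by (simp add: pos_le_divide_eq)
      then have "x ^ i * r \<le> c * y ^ i"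
        unfolding cy using x by (intro mult_left_mono) auto
      then show ?thesis by (simp add: f_def algebra_simps)
    qed
    have f_nonpos: "f i \<le> 0" if "k \<le> i" for i
    proof -
      have "r ^ (2 * k) \<le> r ^ (1 + 2 * i)" using r that by (intro power_increasing) auto
      then have "r ^ (2 * k) / (r * r ^ (2 * i)) \<le> 1" using rpos by simp
      then have "c * y ^ i \<le> x ^ i * 1"
        unfolding cy using x by (intro mult_left_mono) auto
      then show ?thesis by (simp add: f_def)
    qed
    have f_lower: "- (x ^ i) \<le> f i" for i
      using cpos ypos by (simp add: f_def)
    define h where "h i = (if i = n then x ^ n * (r - 1) else 0) - (if k + L \<le> i then x ^ i else 0)"
      for i
    have h_le: "h i \<le> s * d i * f i" for i
    proof -
      consider "i < n" | "i = n" | "n < i" "i < k" | "k \<le> i" "i < k + L" | "k + L \<le> i"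
        by linarith
      then show ?thesis
      proof cases
        case 1
        then show ?thesis using before k by (simp add: h_def)
      next
        case 2
        then show ?thesis using sdn f_ge[of n] k by (simp add: h_def)
      next
        case 3
        have "0 \<le> x ^ i * (r - 1)" using x r by simp
        then have "0 \<le> f i" using f_ge[of i] 3 by linarith
        moreover have "s * d i \<in> {0, 1}" using sd_same same[of i] 3 by simp
        ultimately show ?thesis using 3 by (auto simp: h_def)
      next
        case 4
        then have "w i \<noteq> w n" using next_run[of i] k by simp
        then have "s * d i \<in> {0, -1}" by (rule sd_diff)
        then show ?thesis using f_nonpos[of i] 4 k by (auto simp: h_def)
      next
        case 5
        have "s * d i \<in> {-1, 0, 1}" using sd_same[of i] sd_diff[of i] by auto
        then show ?thesis using f_nonpos[of i] f_lower[of i] 5 k x by (auto simp: h_def)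
      qed
    qed
    have "(\<lambda>i. s * (c * (d i * y ^ i) - d i * x ^ i)) sums (s * (c * 0 - 0))"
      by (intro sums_mult sums_diff sx sy)
    then have sf: "(\<lambda>i. s * d i * f i) sums 0"
      by (simp add: f_def algebra_simps)
    have "(\<lambda>i. x ^ (k + L) * x ^ i) sums (x ^ (k + L) * (1 / (1 - x)))"
      using x by (intro sums_mult geometric_sums) auto
    then have "(\<lambda>i. if k + L \<le> i + (k + L) then x ^ (i + (k + L)) else 0)
                 sums (x ^ (k + L) / (1 - x))"
      by (simp add: power_add mult_ac)
    then have tail: "(\<lambda>i. if k + L \<le> i then x ^ i else 0) sums (x ^ (k + L) / (1 - x))"
      by (subst (asm) sums_iff_shift) simp
    have sh: "h sums (x ^ n * (r - 1) - x ^ (k + L) / (1 - x))"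
      unfolding h_def using sums_single[of n "\<lambda>_. x ^ n * (r - 1)"] tail
      by (intro sums_diff) simp_all
    have "x ^ n * (r - 1) - x ^ (k + L) / (1 - x) \<le> 0"
      using sums_le[OF h_le sh sf] .
    moreover have "x ^ (k + L) / (1 - x) \<le> x ^ n * (x ^ L / (1 - x))"
    proof -
      have "x ^ k \<le> x ^ n" using x k by (intro power_decreasing) auto
      then have "x ^ k * (x ^ L / (1 - x)) \<le> x ^ n * (x ^ L / (1 - x))"
        using x by (intro mult_right_mono) auto
      then show ?thesis by (simp add: power_add)
    qed
    moreover have "x ^ n * (x ^ L / (1 - x)) < x ^ n * (r - 1)"
      using L x by (intro mult_strict_left_mono) auto
    ultimately show False by linarith
  qed
qed

lemma summable_letter_series:
  assumes "b > 1"
  shows "summable (\<lambda>i. letter_val (w i) / b ^ Suc i)"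
proof (rule summable_comparison_test')
  show "summable (\<lambda>i. (1 / b) ^ i)" using assms by (intro summable_geometric) auto
  have "\<bar>letter_val (w i)\<bar> = 1" for i by (cases "w i") auto
  moreover have "1 / b ^ Suc i \<le> 1 / b ^ i" for i
    using assms by (intro divide_left_mono power_increasing) auto
  ultimately show "norm (letter_val (w i) / b ^ Suc i) \<le> (1 / b) ^ i" for i
    using assms by (simp add: power_divide abs_mult)
qed

text \<open>
  Two words with the same sum differ by a sequence orthogonal to the powers of \<open>1 / b\<close>; the factor
  \<open>2\<close> turns the differences of letters into \<open>0\<close> or a letter of \<open>w\<close>.
\<close>

lemma letter_series_eq_imp_orthogonal:
  assumes b: "b > 1"
    and eq: "(\<Sum>i. letter_val (w' i) / b ^ Suc i) = (\<Sum>i. letter_val (w i) / b ^ Suc i)"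
  shows "(\<lambda>i. (letter_val (w i) - letter_val (w' i)) / 2 * (1 / b) ^ i) sums 0"
proof -
  have "(\<lambda>i. letter_val (w i) / b ^ Suc i - letter_val (w' i) / b ^ Suc i) sums 0"
    using sums_diff[OF summable_sums[OF summable_letter_series[OF b, of w]]
        summable_sums[OF summable_letter_series[OF b, of w']]] eq by simp
  from sums_mult[OF this, of "b / 2"]
  have "(\<lambda>i. b / 2 * (letter_val (w i) / b ^ Suc i - letter_val (w' i) / b ^ Suc i)) sums 0"
    by simp
  moreover have "b / 2 * (letter_val (w i) / b ^ Suc i - letter_val (w' i) / b ^ Suc i) =
      (letter_val (w i) - letter_val (w' i)) / 2 * (1 / b) ^ i" for i
    using b by (simp add: power_divide divide_simps)
  ultimately show ?thesis by simp
qed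

lemma unique_addresses_commute: "unique_addresses a b = unique_addresses b a"
  by (auto simp: unique_addresses_def proj_def)

lemma long_runs_unique_address_less:
  assumes b: "1 < b1" "b1 < b2"
  shows "\<exists>L>0. \<forall>w. long_runs L w \<longrightarrow> w \<in> unique_addresses b1 b2"
proof -
  define x where "x = 1 / b1"
  define r where "r = sqrt (b2 / b1)"
  have x: "0 < x" "x < 1" using b by (auto simp: x_def)
  have r: "1 < r" using b by (simp add: r_def)
  have y: "1 / b2 = x / r\<^sup>2" using b by (simp add: x_def r_def)
  have "(\<lambda>L. x ^ L / (1 - x)) \<longlonglongrightarrow> 0 / (1 - x)"
    using x by (intro tendsto_divide LIMSEQ_realpow_zero) auto
  then have "eventually (\<lambda>L. x ^ L / (1 - x) < r - 1) sequentially"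
    using r by (intro order_tendstoD(2)) auto
  from eventually_happens'[OF _ eventually_conj[OF this eventually_gt_at_top[of 0]]]
  obtain L where L: "x ^ L / (1 - x) < r - 1" "L > 0" by auto
  have "w \<in> unique_addresses b1 b2" if runs: "long_runs L w" for w
    unfolding unique_addresses_def
  proof (intro CollectI allI impI notI)
    fix w' assume "w' \<noteq> w" and eq: "proj b1 b2 w' = proj b1 b2 w"
    define d where "d i = (letter_val (w i) - letter_val (w' i)) / 2" for i
    have "d i = 0 \<or> d i = letter_val (w i)" for i
      unfolding d_def by (cases "w i"; cases "w' i") auto
    moreover have "(\<lambda>i. d i * x ^ i) sums 0" "(\<lambda>i. d i * (1 / b2) ^ i) sums 0"
      unfolding d_def x_def using eq b
      by (intro letter_series_eq_imp_orthogonal; simp add: proj_def del: power_Suc)+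
    ultimately have "d i = 0" for i
      by (rule long_runs_orthogonal_imp_zero[OF x r y L(1) runs])
    then have "w' i = w i" for i
      unfolding d_def by (cases "w i"; cases "w' i") (auto dest: meta_spec[of _ i])
    then show False using \<open>w' \<noteq> w\<close> by auto
  qed
  then show ?thesis using L by blast
qed

lemma long_runs_unique_address:
  assumes "b1 > 1" "b2 > 1" "b1 \<noteq> b2"
  shows "\<exists>L>0. \<forall>w. long_runs L w \<longrightarrow> w \<in> unique_addresses b1 b2"
  using assms long_runs_unique_address_less[of b1 b2] long_runs_unique_address_less[of b2 b1]
    unique_addresses_commute[of b1 b2] by (cases "b1 < b2") auto

section \<open>Counting words with long runs\<close>

lemma long_runs_stretch: "long_runs L (\<lambda>i. u (i div L))"
  unfolding long_runs_def
proof (intro allI impI)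
  fix k j assume "u (Suc k div L) \<noteq> u (k div L)" and j: "j < L"
  then have "Suc k div L \<noteq> k div L" by metis
  then have "Suc k mod L = 0" by (auto simp: div_Suc split: if_splits)
  then show "u ((Suc k + j) div L) = u (Suc k div L)"
    using j by (metis add.right_neutral div_add1_eq div_less mod_less add_0)
qed

lemma UNIV_letter: "(UNIV :: letter set) = {LetterP, LetterM}"
  using letter.exhaust by auto

lemma finite_prefixes_of: "finite (prefixes_of n A)"
proof (rule finite_subset)
  show "prefixes_of n A \<subseteq> {xs. set xs \<subseteq> UNIV \<and> length xs = n}"
    by (auto simp: prefixes_of_def)
  show "finite {xs :: letter list. set xs \<subseteq> UNIV \<and> length xs = n}"
    by (intro finite_lists_length_eq) (simp add: UNIV_letter)
qed

text \<open>
  The first \<open>m\<close> letters of \<open>u\<close> can be read off at the positions \<open>j * L\<close>, which lie in the prefix.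
\<close>

lemma num_prefixes_ge:
  assumes L: "L > 0" and A: "\<And>u. (\<lambda>i. u (i div L)) \<in> A" and m: "m * L \<le> n"
  shows "2 ^ m \<le> num_prefixes n A"
proof -
  define X where "X = {xs :: letter list. set xs \<subseteq> UNIV \<and> length xs = m}"
  define u where "u xs j = (if j < m then xs ! j else LetterP)" for xs :: "letter list" and j
  define F where "F xs = map (\<lambda>i. u xs (i div L)) [0..<n]" for xs
  have "inj_on F X"
  proof (rule inj_onI)
    fix xs ys assume X: "xs \<in> X" "ys \<in> X" and eq: "F xs = F ys"
    show "xs = ys"
    proof (rule nth_equalityI)
      show "length xs = length ys" using X by (simp add: X_def)
      fix j assume "j < length xs"
      then have j: "j < m" using X by (simp add: X_def)
      then have "j * L < m * L" using L by simp
      then have "j * L < n" using m by linarith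
      then have "F xs ! (j * L) = u xs j" "F ys ! (j * L) = u ys j"
        using L by (auto simp: F_def)
      then show "xs ! j = ys ! j" using eq j by (simp add: u_def)
    qed
  qed
  moreover have "F ` X \<subseteq> prefixes_of n A"
    unfolding F_def prefixes_of_def using A by blast
  ultimately have "card X \<le> num_prefixes n A"
    unfolding num_prefixes_def using finite_prefixes_of by (rule card_inj_on_le)
  moreover have "card X = 2 ^ m"
    unfolding X_def by (subst card_lists_length_eq) (simp_all add: UNIV_letter numeral_2_eq_2)
  ultimately show ?thesis by simp
qed

lemma positive_topological_entropy_of_stretch:
  assumes L: "L > 0" and A: "\<And>u. (\<lambda>i. u (i div L)) \<in> A"
  shows "positive_topological_entropy A"
proof -
  define C where "C = ln 2 / (2 * real L)"
  have "eventually (\<lambda>n. ereal C \<le> ereal (ln (real (num_prefixes n A)) / real n)) sequentially"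
    using eventually_ge_at_top[of L]
  proof eventually_elim
    case (elim n)
    define m where "m = n div L"
    have "m \<ge> 1" using elim L by (simp add: m_def div_greater_zero_iff Suc_le_eq)
    have "m * L \<le> n" by (simp add: m_def)
    then have "2 ^ m \<le> num_prefixes n A" using L A by (intro num_prefixes_ge) auto
    then have "(2::real) ^ m \<le> real (num_prefixes n A)"
      by (metis of_nat_le_iff of_nat_numeral of_nat_power)
    then have "ln ((2::real) ^ m) \<le> ln (real (num_prefixes n A))"
      by (smt (verit) ln_le_cancel_iff zero_less_power)
    then have *: "real m * ln 2 \<le> ln (real (num_prefixes n A))" by (simp add: ln_realpow)
    \<comment> \<open>Rounding down in \<open>n div L\<close> costs at most a factor \<open>2\<close> once \<open>n \<ge> L\<close>.\<close>
    have "n < Suc m * L"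
      using L unfolding m_def by (metis dividend_less_div_times mult.commute mult_Suc_right)
    also have "\<dots> \<le> 2 * m * L" using \<open>m \<ge> 1\<close> by (intro mult_right_mono) auto
    finally have "real n \<le> 2 * real m * real L"
      by (metis less_imp_le of_nat_le_iff of_nat_mult of_nat_numeral)
    then have "C * real n \<le> C * (2 * real m * real L)"
      using L by (intro mult_left_mono) (auto simp: C_def)
    also have "\<dots> = real m * ln 2" using L by (simp add: C_def)
    also note *
    finally show ?case using elim L by (simp add: pos_le_divide_eq)
  qed
  then have "ereal C \<le> liminf (\<lambda>n. ereal (ln (real (num_prefixes n A)) / real n))"
    by (rule Liminf_bounded)
  moreover have "0 < ereal C" using L by (simp add: C_def)
  ultimately show ?thesis
    unfolding positive_topological_entropy_def by (rule less_le_trans[rotated])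
qed

theorem theorem4p2:
  fixes \<beta>1 \<beta>2 :: real
  assumes "\<beta>1 > 1" and "\<beta>2 > 1" and "\<beta>1 \<noteq> \<beta>2"
  shows "positive_topological_entropy (unique_addresses \<beta>1 \<beta>2)"
proof -
  obtain L where "L > 0" and "\<And>w. long_runs L w \<Longrightarrow> w \<in> unique_addresses \<beta>1 \<beta>2"
    using long_runs_unique_address[OF assms] by blast
  then show ?thesis
    using long_runs_stretch by (intro positive_topological_entropy_of_stretch) auto
qed

end
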